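(* Every odd element of $\bar S$ is cube-free, i.e. not divisible by $p^3$ for any prime $p$.
   Context: For a finite group $G$, the (undirected) power graph $P(G)$ is the graph with vertex set $G$ in which two vertices $a,b$ are adjacent if and only if $a\neq b$ and $a^m=b$ or $b^m=a$ for some positive integer $m$. The set $\bar S$ consists of all natural numbers (positive integers) $n$ such that any two groups of order $n$ with isomorphic power graphs are isomorphic. *)

theory Defs
  imports "HOL-Algebra.Algebra" "HOL-Computational_Algebra.Primes"
begin

hide_const (open) Divisibility.prime

text \<open>A simple graph is given by its vertex set and its adjacency relation (a symmetric,
  irreflexive relation on the vertices).\<close>

type_synonym 'v graph = "'v set \<times> ('v \<times> 'v) set"

definition graph_iso :: "'v graph \<Rightarrow> 'w graph \<Rightarrow> bool" where
  "graph_iso \<Gamma> \<Delta> \<longleftrightarrow>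
     (\<exists>f. bij_betw f (fst \<Gamma>) (fst \<Delta>) \<and>
          (\<forall>a\<in>fst \<Gamma>. \<forall>b\<in>fst \<Gamma>. (a, b) \<in> snd \<Gamma> \<longleftrightarrow> (f a, f b) \<in> snd \<Delta>))"

definition power_graph :: "('a, 'm) monoid_scheme \<Rightarrow> 'a graph" where
  "power_graph G =
     (carrier G,
      {(a, b). a \<in> carrier G \<and> b \<in> carrier G \<and> a \<noteq> b \<and>
               (\<exists>m::nat. m > 0 \<and> (a [^]\<^bsub>G\<^esub> m = b \<or> b [^]\<^bsub>G\<^esub> m = a))})"

text \<open>A definition cannot quantify over types, so the groups range over those whose elements
  are natural numbers.  Every finite group is isomorphic to such a group, and
  \<open>S_bar_all_types\<close> below shows that nothing is lost.  Since \<open>n > 0\<close>, a group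
  of order \<open>n\<close> is finite.\<close>

definition S_bar :: "nat set" where
  "S_bar = {n. n > 0 \<and>
     (\<forall>(G :: nat monoid) (H :: nat monoid).
        group G \<longrightarrow> group H \<longrightarrow> order G = n \<longrightarrow> order H = n \<longrightarrow>
        graph_iso (power_graph G) (power_graph H) \<longrightarrow> G \<cong> H)}"

lemma power_graph_iso_if_iso:
  assumes "group G" "group H" "G \<cong> H"
  shows "graph_iso (power_graph G) (power_graph H)"
proof -
  obtain f where f: "f \<in> iso G H"
    using assms(3) by (auto simp: is_iso_def)
  then have bij: "bij_betw f (carrier G) (carrier H)" and hom: "f \<in> hom G H"
    by (auto simp: iso_def)
  interpret group_hom G H f
    using assms hom by (simp add: group_hom_def group_hom_axioms_def)
  have inj: "f x = f y \<longleftrightarrow> x = y" if "x \<in> carrier G" "y \<in> carrier G" for x y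
    using bij that by (auto simp: bij_betw_def inj_on_def)
  have pow: "f a [^]\<^bsub>H\<^esub> m = f b \<longleftrightarrow> a [^]\<^bsub>G\<^esub> m = b"
    if "a \<in> carrier G" "b \<in> carrier G" for a b and m :: nat
    using that inj[of "a [^]\<^bsub>G\<^esub> m" b] by (simp add: hom_nat_pow)
  show ?thesis
    unfolding graph_iso_def power_graph_def
    by (rule exI[of _ f]) (use bij in \<open>auto simp: inj pow\<close>)
qed

lemma graph_iso_sym: "graph_iso \<Gamma> \<Delta> \<Longrightarrow> graph_iso \<Delta> \<Gamma>"
proof -
  assume "graph_iso \<Gamma> \<Delta>"
  then obtain f where f: "bij_betw f (fst \<Gamma>) (fst \<Delta>)"
    and e: "\<And>a b. a \<in> fst \<Gamma> \<Longrightarrow> b \<in> fst \<Gamma> \<Longrightarrow> (a, b) \<in> snd \<Gamma> \<longleftrightarrow> (f a, f b) \<in> snd \<Delta>"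
    unfolding graph_iso_def by blast
  let ?g = "inv_into (fst \<Gamma>) f"
  have g: "bij_betw ?g (fst \<Delta>) (fst \<Gamma>)"
    using f by (rule bij_betw_inv_into)
  have "(a, b) \<in> snd \<Delta> \<longleftrightarrow> (?g a, ?g b) \<in> snd \<Gamma>" if "a \<in> fst \<Delta>" "b \<in> fst \<Delta>" for a b
    using e[of "?g a" "?g b"] g that bij_betw_inv_into_right[OF f]
    by (simp add: bij_betwE)
  then show "graph_iso \<Delta> \<Gamma>"
    unfolding graph_iso_def using g by blast
qed

lemma graph_iso_trans: "graph_iso \<Gamma> \<Delta> \<Longrightarrow> graph_iso \<Delta> \<Theta> \<Longrightarrow> graph_iso \<Gamma> \<Theta>"
proof -
  assume "graph_iso \<Gamma> \<Delta>" "graph_iso \<Delta> \<Theta>"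
  then obtain f g where "bij_betw f (fst \<Gamma>) (fst \<Delta>)" "bij_betw g (fst \<Delta>) (fst \<Theta>)"
    and "\<forall>a\<in>fst \<Gamma>. \<forall>b\<in>fst \<Gamma>. (a, b) \<in> snd \<Gamma> \<longleftrightarrow> (f a, f b) \<in> snd \<Delta>"
    and "\<forall>a\<in>fst \<Delta>. \<forall>b\<in>fst \<Delta>. (a, b) \<in> snd \<Delta> \<longleftrightarrow> (g a, g b) \<in> snd \<Theta>"
    unfolding graph_iso_def by blast
  then show "graph_iso \<Gamma> \<Theta>"
    unfolding graph_iso_def
    by (intro exI[of _ "g \<circ> f"]) (simp add: bij_betw_trans bij_betwE)
qed

lemma finite_group_nat_copy:
  fixes G :: "('a, 'm) monoid_scheme"
  assumes "group G" "finite (carrier G)"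
  obtains G' :: "nat monoid" where "group G'" "G \<cong> G'"
proof -
  obtain f :: "'a \<Rightarrow> nat" where "inj_on f (carrier G)"
    using finite_imp_inj_to_nat_seg[OF assms(2)] by auto
  then have "group (image_group f G)" "f \<in> iso G (image_group f G)"
    by (rule group.inj_imp_image_group_is_group[OF assms(1)], rule inj_imp_image_group_iso)
  then show ?thesis
    by (intro that is_isoI)
qed

lemma S_bar_all_types:
  fixes G :: "('a, 'm) monoid_scheme" and H :: "('b, 'k) monoid_scheme"
  assumes n: "n \<in> S_bar" and G: "group G" "order G = n" and H: "group H" "order H = n"
    and iso: "graph_iso (power_graph G) (power_graph H)"
  shows "G \<cong> H"
proof -
  have "n > 0"
    using n by (simp add: S_bar_def)
  then have "finite (carrier G)" "finite (carrier H)"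
    using G(2) H(2) by (simp_all add: order_def card_ge_0_finite)
  obtain G' :: "nat monoid" where G': "group G'" "G \<cong> G'"
    by (rule finite_group_nat_copy[OF G(1) \<open>finite (carrier G)\<close>])
  obtain H' :: "nat monoid" where H': "group H'" "H \<cong> H'"
    by (rule finite_group_nat_copy[OF H(1) \<open>finite (carrier H)\<close>])
  have "order G' = n" "order H' = n"
    using G(2) H(2) iso_same_card[OF G'(2)] iso_same_card[OF H'(2)] by (simp_all add: order_def)
  moreover have "graph_iso (power_graph G') (power_graph H')"
    by (rule graph_iso_trans[OF graph_iso_trans[OF
          graph_iso_sym[OF power_graph_iso_if_iso[OF G(1) G']] iso]
          power_graph_iso_if_iso[OF H(1) H']])
  ultimately have "G' \<cong> H'"
    using n G'(1) H'(1) unfolding S_bar_def by simp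
  from iso_trans[OF iso_trans[OF G'(2) this] group.iso_sym[OF H(1) H'(2)]]
  show ?thesis .
qed

end

(*
  On Z_p^3 x Z_m twist the addition by the alternating bilinear form a b' - b a' in the third
  coordinate.  The form vanishes on pairs of multiples of one vector, so powers are the same in
  the twisted and in the untwisted group, and the two power graphs coincide.  For odd p > 1 the
  twisted group is not commutative (its p-part is the Heisenberg group), whereas the untwisted
  one is.
*)

theory Submission
  imports Defs
begin

text \<open>The factor \<open>e\<close> scales the form, so that \<open>e = 0\<close> (the direct
  product) and \<open>e = 1\<close> (the twisted group) share one proof of the group axioms and one
  formula for powers. Residues are integers because the form involves a difference.\<close>

definition twisted_group ::
    "int \<Rightarrow> int \<Rightarrow> int \<Rightarrow> (int \<times> int \<times> int \<times> int) monoid" where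
  "twisted_group e p m =
     \<lparr>carrier = {0..<p} \<times> {0..<p} \<times> {0..<p} \<times> {0..<m},
      monoid.mult = (\<lambda>(a, b, c, d) (a', b', c', d').
        ((a + a') mod p, (b + b') mod p, (c + c' + e * (a * b' - b * a')) mod p, (d + d') mod m)),
      one = (0, 0, 0, 0)\<rparr>"

lemma order_twisted_group:
  "order (twisted_group e (int p) (int m)) = p ^ 3 * m"
  by (simp add: order_def twisted_group_def card_cartesian_product power3_eq_cube)

lemma group_twisted_group:
  assumes "p > 0" "m > 0"
  shows "group (twisted_group e p m)"
proof (rule groupI)
  fix x y z :: "int \<times> int \<times> int \<times> int"
  obtain a b c d where x: "x = (a, b, c, d)" by (cases x)
  obtain a' b' c' d' where y: "y = (a', b', c', d')" by (cases y)
  obtain a'' b'' c'' d'' where z: "z = (a'', b'', c'', d'')" by (cases z)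
  \<comment> \<open>The third coordinate is the only one where associativity is not immediate. On
    each side, congruences modulo \<open>p\<close> strip the inner reductions, including those
    inside the arguments of the form.\<close>
  have "((c + c' + e * (a * b' - b * a')) mod p + c''
          + e * ((a + a') mod p * b'' - (b + b') mod p * a'')) mod p
      = (c + c' + e * (a * b' - b * a') + c'' + e * ((a + a') * b'' - (b + b') * a'')) mod p"
    by (intro mod_add_cong mod_diff_cong mod_mult_cong refl mod_mod_trivial)
  moreover have "(c + (c' + c'' + e * (a' * b'' - b' * a'')) mod p
          + e * (a * ((b' + b'') mod p) - b * ((a' + a'') mod p))) mod p
      = (c + (c' + c'' + e * (a' * b'' - b' * a'')) + e * (a * (b' + b'') - b * (a' + a''))) mod p"
    by (intro mod_add_cong mod_diff_cong mod_mult_cong refl mod_mod_trivial)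
  \<comment> \<open>This is the cocycle identity B(x, y) + B(x + y, z) = B(y, z) + B(x, y + z),
    which holds for every bilinear B.\<close>
  moreover have "c + c' + e * (a * b' - b * a') + c'' + e * ((a + a') * b'' - (b + b') * a'')
      = c + (c' + c'' + e * (a' * b'' - b' * a'')) + e * (a * (b' + b'') - b * (a' + a''))"
    by (simp add: algebra_simps)
  ultimately have assoc: "((c + c' + e * (a * b' - b * a')) mod p + c''
          + e * ((a + a') mod p * b'' - (b + b') mod p * a'')) mod p
      = (c + (c' + c'' + e * (a' * b'' - b' * a'')) mod p
          + e * (a * ((b' + b'') mod p) - b * ((a' + a'') mod p))) mod p"
    by (simp only:)
  show "x \<otimes>\<^bsub>twisted_group e p m\<^esub> y \<otimes>\<^bsub>twisted_group e p m\<^esub> z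
      = x \<otimes>\<^bsub>twisted_group e p m\<^esub> (y \<otimes>\<^bsub>twisted_group e p m\<^esub> z)"
    by (simp only: twisted_group_def x y z monoid.simps prod.case assoc)
      (simp add: mod_simps add.assoc)
next
  fix x assume "x \<in> carrier (twisted_group e p m)"
  then show "\<exists>y\<in>carrier (twisted_group e p m).
      y \<otimes>\<^bsub>twisted_group e p m\<^esub> x = \<one>\<^bsub>twisted_group e p m\<^esub>"
  proof (cases x)
    case (fields a b c d)
    \<comment> \<open>The form vanishes on a vector and its negative, so inverses are the
      coordinatewise negatives, whatever \<open>e\<close> is.\<close>
    have "((- c) mod p + c + e * ((- a) mod p * b - (- b) mod p * a)) mod p
        = (- c + c + e * ((- a) * b - (- b) * a)) mod p"
      by (intro mod_add_cong mod_diff_cong mod_mult_cong refl mod_mod_trivial)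
    then show ?thesis
      using assms
      by (intro bexI[of _ "((- a) mod p, (- b) mod p, (- c) mod p, (- d) mod m)"])
        (auto simp: twisted_group_def fields mod_simps)
  qed
qed (use assms in \<open>auto simp: twisted_group_def\<close>)

text \<open>Multiplying the \<open>k\<close>-th power by one more factor evaluates the form on (k a,
  k b) and (a, b), where it is 0 modulo \<open>p\<close>. Hence \<open>e\<close> drops out of the
  result.\<close>

lemma twisted_group_nat_pow:
  "(a, b, c, d) [^]\<^bsub>twisted_group e p m\<^esub> (k :: nat)
     = (int k * a mod p, int k * b mod p, int k * c mod p, int k * d mod m)"
proof (induction k)
  case 0
  then show ?case by (simp add: twisted_group_def nat_pow_def)
next
  case (Suc k)
  have "(int k * c mod p + c + e * (int k * a mod p * b - int k * b mod p * a)) mod p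
      = (int k * c + c + e * (int k * a * b - int k * b * a)) mod p"
    by (intro mod_add_cong mod_diff_cong mod_mult_cong refl mod_mod_trivial)
  also have "\<dots> = (int (Suc k) * c) mod p"
    by (simp add: algebra_simps)
  finally show ?case
    using Suc by (simp add: twisted_group_def nat_pow_def mod_simps algebra_simps)
qed

lemma power_graph_twisted_group:
  "power_graph (twisted_group e p m) = power_graph (twisted_group e' p m)"
proof -
  have "x [^]\<^bsub>twisted_group e p m\<^esub> k = x [^]\<^bsub>twisted_group e' p m\<^esub> k"
    for x and k :: nat
    by (cases x) (simp add: twisted_group_nat_pow)
  moreover have "carrier (twisted_group e p m) = carrier (twisted_group e' p m)"
    by (simp add: twisted_group_def)
  ultimately show ?thesis
    by (simp add: power_graph_def)
qed

lemma twisted_group_not_iso: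
  assumes "p > 1" "odd p" "m > 0"
  shows "\<not> twisted_group 0 p m \<cong> twisted_group 1 p m"
proof
  interpret group "twisted_group 0 p m"
    using assms by (simp add: group_twisted_group)
  have "comm_group (twisted_group 0 p m)"
    by (rule group_comm_groupI) (auto simp: twisted_group_def add.commute)
  moreover assume "twisted_group 0 p m \<cong> twisted_group 1 p m"
  moreover have "group (twisted_group 1 p m)"
    using assms by (simp add: group_twisted_group)
  ultimately have "comm_group (twisted_group 1 p m)"
    by (blast intro: comm_group.iso_imp_comm_group group.is_monoid)
  then interpret H: comm_group "twisted_group 1 p m" .
  \<comment> \<open>The form takes the values 1 and -1 on these two vectors in the two orders, so
    commuting forces 1 and -1 to agree modulo \<open>p\<close>. This is where an odd
    \<open>p\<close> matters.\<close>
  have "(1, 0, 0, 0) \<otimes>\<^bsub>twisted_group 1 p m\<^esub> (0, 1, 0, 0)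
      = (0, 1, 0, 0) \<otimes>\<^bsub>twisted_group 1 p m\<^esub> (1, 0, 0, 0)"
    using assms by (intro H.m_comm) (auto simp: twisted_group_def)
  then have "1 mod p = - 1 mod p"
    by (simp add: twisted_group_def)
  then have "p dvd 2"
    by (simp add: mod_eq_dvd_iff)
  then show False
    using assms zdvd_imp_le[of p 2] by (cases "p = 2") auto
qed

theorem corollary2p5:
  fixes n p :: nat
  assumes "n \<in> S_bar" and "odd n" and "Factorial_Ring.prime p"
  shows "\<not> p ^ 3 dvd n"
proof
  assume "p ^ 3 dvd n"
  then obtain m where n: "n = p ^ 3 * m" by (elim dvdE)
  \<comment> \<open>Oddness of \<open>n\<close> gives both that \<open>m\<close> is nonzero, as 0 is
    even, and that \<open>p\<close> is odd.\<close>
  have m: "int m > 0" and p: "odd (int p)" "int p > 1"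
    using assms(2) prime_gt_1_nat[OF assms(3)] by (auto simp: n odd_pos)
  \<comment> \<open>The two power graphs are equal, so reflexivity is enough.\<close>
  have "graph_iso \<Gamma> \<Gamma>" for \<Gamma> :: "'v graph"
    unfolding graph_iso_def by (rule exI[of _ id]) simp
  then have "graph_iso (power_graph (twisted_group 0 p m)) (power_graph (twisted_group 1 p m))"
    by (subst power_graph_twisted_group[where e' = 1])
  \<comment> \<open>The elements are quadruples of integers, while \<open>S_bar\<close> speaks of
    groups on natural numbers; \<open>S_bar_all_types\<close> bridges the gap.\<close>
  then have "twisted_group 0 p m \<cong> twisted_group 1 p m"
    using m p
    by (intro S_bar_all_types[OF assms(1)])
      (simp_all add: n group_twisted_group order_twisted_group)
  then show False
    using twisted_group_not_iso m p by blast
qed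

end
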